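(* Let $m_i = p_i/p_{i^*}$ for $i\in\mathcal{N}\setminus\{i^*\}$. Consider a file of size $F\in(k\Delta r_{i^*},(k+1)\Delta r_{i^*})$ for some $k\in\{0,1,2,\dots\}$. Then $$\frac{\mathbb{E}[T(i_{so}(F),F)]}{\mathbb{E}[T(i^*,F)]}\le \min_{i\in\mathcal{N}\setminus\{i^*\}}\left\{1,\ \frac{\dfrac{F}{\Delta r_ip_i}+\dfrac{1-p_i}{p_i}}{(k+1)\left(\dfrac{m_i}{p_i}-1\right)}\right\}.$$
   Context: Let $\mathcal{N}=\{1,\dots,N\}$, $N\ge 2$, be a finite set of channels, $\Delta>0$ a fixed slot duration, and for each $i\in\mathcal{N}$ let $r_i>0$ (rate) and $p_i\in(0,1]$ (availability probability). For each $i$, $\{Y_i(k)\}_{k\ge 0}$ is an i.i.d. sequence of Bernoulli random variables with $P[Y_i(k)=1]=p_i$, and the sequences are independent over $i$. The state of channel $i$ at time $t\ge 0$ is $X_i(t)=Y_i(\lfloor t/\Delta\rfloor)$. The static policy for channel $i$ uses channel $i$ at all times; its transfer time for a file of size $F>0$ is $T(i,F)=\min\{T\ge 0:\int_0^T r_iX_i(t)\,dt\ge F\}$. The static optimal channel is $i_{so}(F)=\arg\min_{k\in\mathcal{N}}\mathbb{E}[T(k,F)]$. The max-throughput channel is $i^*=\arg\max_{k\in\mathcal{N}}r_kp_k$, assumed unique: $r_{i^*}p_{i^*}>r_kp_k$ for all $k\ne i^*$. It is assumed that $p_{i^*}<1$, so that $m_i/p_i=1/p_{i^*}>1$. *)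

theory Defs
  imports "HOL-Probability.Probability"
begin

locale channel_model = prob_space M for M :: "'w measure" +
  fixes N :: nat and \<Delta> :: real and r p :: "nat \<Rightarrow> real"
    and Y :: "nat \<Rightarrow> nat \<Rightarrow> 'w \<Rightarrow> bool"
  assumes two_channels: "N \<ge> 2"
    and slot_pos: "\<Delta> > 0"
    and rate_pos: "\<And>i. i \<in> {1..N} \<Longrightarrow> r i > 0"
    and prob_range: "\<And>i. i \<in> {1..N} \<Longrightarrow> p i \<in> {0<..1}"
    and bernoulli: "\<And>i k. i \<in> {1..N} \<Longrightarrow> prob {\<omega> \<in> space M. Y i k \<omega>} = p i"
    and indep_slots: "\<And>i. i \<in> {1..N} \<Longrightarrow> indep_vars (\<lambda>_. count_space UNIV) (Y i) UNIV"
    and indep_channels: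
      "indep_vars (\<lambda>_. Pi\<^sub>M UNIV (\<lambda>_::nat. count_space UNIV)) (\<lambda>i \<omega> k. Y i k \<omega>) {1..N}"

(* The 0/1 values of the Bernoulli variables are encoded as False/True. *)
definition channel_state ::
    "real \<Rightarrow> (nat \<Rightarrow> nat \<Rightarrow> 'w \<Rightarrow> bool) \<Rightarrow> nat \<Rightarrow> real \<Rightarrow> 'w \<Rightarrow> real" where
  "channel_state \<Delta> Y i t \<omega> = of_bool (Y i (nat \<lfloor>t / \<Delta>\<rfloor>) \<omega>)"

(* The minimum of the empty set is read as infinity. On a nonempty set the minimum exists,
   since the transferred amount is continuous in T, so LEAST is well defined. *)
definition transfer_time ::
    "real \<Rightarrow> (nat \<Rightarrow> real) \<Rightarrow> (nat \<Rightarrow> nat \<Rightarrow> 'w \<Rightarrow> bool) \<Rightarrow> nat \<Rightarrow> real \<Rightarrow> 'w \<Rightarrow> ennreal" where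
  "transfer_time \<Delta> r Y i F \<omega> =
    (if \<exists>T\<ge>0. integral {0..T} (\<lambda>t. r i * channel_state \<Delta> Y i t \<omega>) \<ge> F
     then ennreal (LEAST T. T \<ge> 0 \<and> integral {0..T} (\<lambda>t. r i * channel_state \<Delta> Y i t \<omega>) \<ge> F)
     else \<infinity>)"

definition expected_transfer_time ::
    "'w measure \<Rightarrow> real \<Rightarrow> (nat \<Rightarrow> real) \<Rightarrow> (nat \<Rightarrow> nat \<Rightarrow> 'w \<Rightarrow> bool) \<Rightarrow> nat \<Rightarrow> real \<Rightarrow> ennreal" where
  "expected_transfer_time M \<Delta> r Y i F = (\<integral>\<^sup>+ \<omega>. transfer_time \<Delta> r Y i F \<omega> \<partial>M)"

(* The minimiser need not be unique; the static optimal channel is any one of them. *)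
definition static_optimal ::
    "'w measure \<Rightarrow> nat \<Rightarrow> real \<Rightarrow> (nat \<Rightarrow> real) \<Rightarrow> (nat \<Rightarrow> nat \<Rightarrow> 'w \<Rightarrow> bool) \<Rightarrow> real \<Rightarrow> nat \<Rightarrow> bool" where
  "static_optimal M N \<Delta> r Y F i \<longleftrightarrow>
    is_arg_min (\<lambda>k. expected_transfer_time M \<Delta> r Y k F) (\<lambda>k. k \<in> {1..N}) i"

definition unique_max_throughput ::
    "nat \<Rightarrow> (nat \<Rightarrow> real) \<Rightarrow> (nat \<Rightarrow> real) \<Rightarrow> nat \<Rightarrow> bool" where
  "unique_max_throughput N r p i \<longleftrightarrow>
    i \<in> {1..N} \<and> (\<forall>k\<in>{1..N} - {i}. r k * p k < r i * p i)"

end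

theory Submission
  imports Defs
begin

text \<open>
  A file of size \<open>F\<close> needs exactly \<open>n = \<lceil>F / (\<Delta> r)\<rceil>\<close> available slots of a channel with rate \<open>r\<close>:
  \<open>n - 1\<close> of them are used completely, and the \<open>n\<close>-th one is used up to the moment at which the
  file is complete. So the transfer time is \<open>F / r\<close>, the time spent transmitting, plus \<open>\<Delta>\<close> for
  each unavailable slot that precedes the \<open>n\<close>-th available one (\<open>transfer_time_eq\<close>).

  The number \<open>W\<close> of slots up to the \<open>n\<close>-th available one has expectation \<open>n / p\<close>. This is Wald's
  identity: whether slot \<open>j\<close> is available is independent of whether fewer than \<open>n\<close> of the earlier
  slots were, so summing over \<open>j\<close> the probability of both gives \<open>p \<cdot> E[W]\<close>; but
  that sum also is the expected number of available slots among the first \<open>W\<close>, which is \<open>n\<close>.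
  Hence \<open>E[T] = F / r + \<Delta> n (1 / p - 1)\<close> (\<open>expected_transfer_time_eq\<close>).

  For the max-throughput channel \<open>n = k + 1\<close>, and dropping the term \<open>F / r\<close> bounds \<open>E[T]\<close> from
  below by \<open>\<Delta> (k + 1) (1 / p - 1)\<close>. For every other channel \<open>n \<le> F / (\<Delta> r) + 1\<close> bounds \<open>E[T]\<close>
  from above by \<open>\<Delta> (F / (\<Delta> r p) + (1 - p) / p)\<close>. As the static optimal channel is at least as
  good as any channel, the ratio is at most \<open>1\<close> and at most each quotient of these two bounds.
\<close>

section \<open>Counting available slots along a sample path\<close>

definition ons_before :: "(nat \<Rightarrow> bool) \<Rightarrow> nat \<Rightarrow> nat" where
  "ons_before f j = (\<Sum>l<j. of_bool (f l))"

lemma ons_before_0 [simp]: "ons_before f 0 = 0"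
  and ons_before_Suc [simp]: "ons_before f (Suc j) = ons_before f j + of_bool (f j)"
  by (simp_all add: ons_before_def)

lemma ons_before_mono: "i \<le> j \<Longrightarrow> ons_before f i \<le> ons_before f j"
  unfolding ons_before_def by (rule sum_mono2) auto

lemma ons_before_le: "ons_before f j \<le> j"
  by (induction j) (auto simp: le_SucI)

lemma nth_on_slot_exists:
  assumes "n > 0" "n \<le> ons_before f j"
  obtains t where "f t" "Suc (ons_before f t) = n"
proof -
  define s where "s = (LEAST j. n \<le> ons_before f j)"
  have s: "n \<le> ons_before f s"
    unfolding s_def using assms(2) by (rule LeastI)
  with assms(1) obtain t where t: "s = Suc t"
    by (cases s) auto
  have "\<not> n \<le> ons_before f t"
    using not_less_Least[of t "\<lambda>j. n \<le> ons_before f j"] t by (simp add: s_def)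
  with s t show thesis
    by (intro that[of t]) (auto split: if_splits simp: of_bool_def)
qed

lemma ons_before_less_iff:
  assumes "f t" "Suc (ons_before f t) = n"
  shows "ons_before f j < n \<longleftrightarrow> j \<le> t"
  using ons_before_mono[of j t f] ons_before_mono[of "Suc t" j f] assms by fastforce

lemma used_on_slots_partial:
  "(\<Sum>j<m. of_bool (f j \<and> ons_before f j < n)) = min (ons_before f m) n"
  by (induction m) auto

text \<open>The bound holds also on paths with fewer than \<open>n\<close> available slots. So it survives taking
  expectations before the \<open>n\<close>-th available slot is known to exist almost surely.\<close>

lemma used_on_slots_le: "(\<Sum>j. of_bool (f j \<and> ons_before f j < n) :: ennreal) \<le> of_nat n"
proof (rule suminf_le_const)
  fix m
  have "(\<Sum>j<m. of_bool (f j \<and> ons_before f j < n) :: ennreal)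
      = of_nat (\<Sum>j<m. of_bool (f j \<and> ons_before f j < n))"
    by simp
  also have "\<dots> \<le> of_nat n"
    unfolding used_on_slots_partial by simp
  finally show "(\<Sum>j<m. of_bool (f j \<and> ons_before f j < n) :: ennreal) \<le> of_nat n" .
qed simp

lemma used_on_slots_eq:
  assumes "n \<le> ons_before f j"
  shows "(\<Sum>j. of_bool (f j \<and> ons_before f j < n) :: ennreal) = of_nat n"
proof (rule antisym[OF used_on_slots_le])
  have "of_nat n = (of_nat (\<Sum>i<j. of_bool (f i \<and> ons_before f i < n)) :: ennreal)"
    unfolding used_on_slots_partial using assms by simp
  also have "\<dots> = (\<Sum>i<j. of_bool (f i \<and> ons_before f i < n))"
    by simp
  also have "\<dots> \<le> (\<Sum>j. of_bool (f j \<and> ons_before f j < n))"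
    by (rule sum_le_suminf) auto
  finally show "of_nat n \<le> (\<Sum>j. of_bool (f j \<and> ons_before f j < n) :: ennreal)" .
qed

definition slots_until :: "nat \<Rightarrow> (nat \<Rightarrow> bool) \<Rightarrow> ennreal" where
  "slots_until n f = (\<Sum>j. of_bool (ons_before f j < n))"

definition wasted_slots :: "nat \<Rightarrow> (nat \<Rightarrow> bool) \<Rightarrow> ennreal" where
  "wasted_slots n f = (\<Sum>j. of_bool (\<not> f j \<and> ons_before f j < n))"

lemma slots_until_split:
  "slots_until n f = wasted_slots n f + (\<Sum>j. of_bool (f j \<and> ons_before f j < n))"
  unfolding slots_until_def wasted_slots_def
  by (subst suminf_add) (auto intro!: suminf_cong)

lemma slots_until_eq:
  assumes "f t" "Suc (ons_before f t) = n"
  shows "slots_until n f = of_nat (Suc t)"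
proof -
  have "slots_until n f = (\<Sum>j\<in>{..t}. of_bool (j \<le> t))"
    unfolding slots_until_def ons_before_less_iff[OF assms] by (rule suminf_finite) auto
  then show ?thesis
    by simp
qed

lemma wasted_slots_eq:
  assumes "f t" "Suc (ons_before f t) = n"
  shows "wasted_slots n f = of_nat (Suc t - n)"
proof -
  have "wasted_slots n f + of_nat n = of_nat (Suc t)"
    using slots_until_split[of n f] slots_until_eq[OF assms]
      used_on_slots_eq[of n f "Suc t"] assms by simp
  also have "\<dots> = of_nat (Suc t - n) + (of_nat n :: ennreal)"
    using ons_before_le[of f t] assms(2) by (simp flip: of_nat_add)
  finally show ?thesis
    by (metis add.commute ennreal_add_left_cancel ennreal_of_nat_neq_top infinity_ennreal_def)
qed

lemma slots_until_finite:
  assumes "slots_until n f < \<infinity>"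
  shows "\<exists>j. n \<le> ons_before f j"
proof (rule ccontr)
  assume "\<not> ?thesis"
  then have "slots_until n f = (\<Sum>j::nat. 1)"
    by (simp add: slots_until_def not_le)
  moreover have "of_nat m \<le> (\<Sum>j::nat. 1 :: ennreal)" for m
    using sum_le_suminf[of "\<lambda>_::nat. 1 :: ennreal" "{..<m}"] by simp
  ultimately show False
    using assms by (metis ennreal_Ex_less_of_nat infinity_ennreal_def leD)
qed

section \<open>The transfer time along a sample path\<close>

lemma has_integral_within_slot:
  fixes \<Delta> T :: real
  assumes "\<Delta> > 0" "real j * \<Delta> \<le> T" "T \<le> real (Suc j) * \<Delta>"
  shows "((\<lambda>t. of_bool (f (nat \<lfloor>t / \<Delta>\<rfloor>)) :: real) has_integral of_bool (f j) * (T - real j * \<Delta>))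
    {real j * \<Delta>..T}"
proof (rule has_integral_spike_finite[where S = "{real (Suc j) * \<Delta>}"])
  fix t assume t: "t \<in> {real j * \<Delta>..T} - {real (Suc j) * \<Delta>}"
  then have "t < real (Suc j) * \<Delta>" "real j * \<Delta> \<le> t"
    using assms(3) by auto
  then have "\<lfloor>t / \<Delta>\<rfloor> = int j"
    using assms(1) by (intro floor_unique) (auto simp: field_simps)
  then show "of_bool (f (nat \<lfloor>t / \<Delta>\<rfloor>)) = (of_bool (f j) :: real)"
    by simp
next
  show "((\<lambda>_. of_bool (f j) :: real) has_integral of_bool (f j) * (T - real j * \<Delta>)) {real j * \<Delta>..T}"
    using has_integral_const_real[of "of_bool (f j) :: real" "real j * \<Delta>" T] assms(2)
    by (simp add: mult.commute)
qed simp

lemma has_integral_full_slots: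
  fixes \<Delta> :: real
  assumes "\<Delta> > 0"
  shows "((\<lambda>t. of_bool (f (nat \<lfloor>t / \<Delta>\<rfloor>)) :: real) has_integral real (ons_before f j) * \<Delta>)
    {0..real j * \<Delta>}"
proof (induction j)
  case 0
  show ?case by (simp add: has_integral_refl)
next
  case (Suc j)
  have le: "real j * \<Delta> \<le> real (Suc j) * \<Delta>"
    using assms by (intro mult_right_mono) auto
  have "((\<lambda>t. of_bool (f (nat \<lfloor>t / \<Delta>\<rfloor>)) :: real) has_integral
     real (ons_before f j) * \<Delta> + of_bool (f j) * (real (Suc j) * \<Delta> - real j * \<Delta>))
    {0..real (Suc j) * \<Delta>}"
    by (rule has_integral_combine[OF _ le Suc has_integral_within_slot]) (use assms le in auto)
  then show ?case
    by (simp add: algebra_simps)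
qed

lemma integral_channel:
  fixes \<Delta> T c :: real
  assumes "\<Delta> > 0" "real j * \<Delta> \<le> T" "T \<le> real (Suc j) * \<Delta>"
  shows "integral {0..T} (\<lambda>t. c * of_bool (f (nat \<lfloor>t / \<Delta>\<rfloor>)))
    = c * (real (ons_before f j) * \<Delta> + of_bool (f j) * (T - real j * \<Delta>))"
proof -
  have "((\<lambda>t. of_bool (f (nat \<lfloor>t / \<Delta>\<rfloor>)) :: real) has_integral
     real (ons_before f j) * \<Delta> + of_bool (f j) * (T - real j * \<Delta>)) {0..T}"
    by (rule has_integral_combine[OF _ assms(2) has_integral_full_slots has_integral_within_slot])
      (use assms in auto)
  then show ?thesis
    by (intro integral_unique has_integral_mult_right)
qed

text \<open>Up to the beginning of the \<open>n\<close>-th available slot \<open>t\<close> at most \<open>(n - 1) \<Delta> r\<^sub>i < F\<close> has been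
  transferred. During that slot the amount grows with slope \<open>r\<^sub>i\<close> to \<open>n \<Delta> r\<^sub>i \<ge> F\<close>, so it first
  reaches \<open>F\<close> inside the slot, after the time \<open>F / r\<^sub>i - (n - 1) \<Delta>\<close>.\<close>

lemma transfer_time_nth_on_slot:
  fixes \<Delta> F :: real
  assumes "\<Delta> > 0" "r i > 0" and F: "(real n - 1) * (\<Delta> * r i) < F" "F \<le> real n * (\<Delta> * r i)"
    and t: "Y i t \<omega>" "Suc (ons_before (\<lambda>k. Y i k \<omega>) t) = n"
  shows "transfer_time \<Delta> r Y i F \<omega> = ennreal (F / r i + \<Delta> * (real (Suc t) - real n))"
proof -
  define f where "f = (\<lambda>k. Y i k \<omega>)"
  define T0 where "T0 = F / r i + \<Delta> * (real (Suc t) - real n)"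
  define G where "G = (\<lambda>T. integral {0..T} (\<lambda>t. r i * channel_state \<Delta> Y i t \<omega>))"
  have G: "G T = r i * (real (ons_before f j) * \<Delta> + of_bool (f j) * (T - real j * \<Delta>))"
    if "real j * \<Delta> \<le> T" "T \<le> real (Suc j) * \<Delta>" for T j
    using integral_channel[OF assms(1) that, of "r i" f]
    by (simp add: G_def channel_state_def f_def)
  have ft: "f t" and n: "real n = real (ons_before f t) + 1"
    using t by (auto simp: f_def)
  have F': "(real n - 1) * \<Delta> < F / r i" "F / r i \<le> real n * \<Delta>"
    using F assms(2) by (simp_all add: field_simps)
  have T0: "real t * \<Delta> < T0" "T0 \<le> real (Suc t) * \<Delta>"
    using F' by (simp_all add: T0_def algebra_simps)
  have GT0: "G T0 = F"
    using assms(2) ft n by (subst G[of t]) (use T0 in \<open>auto simp: T0_def field_simps\<close>)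
  have T0_nonneg: "0 \<le> T0"
    using T0(1) assms(1) by (smt (verit) mult_nonneg_nonneg of_nat_0_le_iff)
  have least: "T0 \<le> T" if "0 \<le> T" "F \<le> G T" for T
  proof (rule ccontr)
    assume "\<not> T0 \<le> T"
    then have less: "T < T0" by simp
    have "G T < F"
    proof (cases "real t * \<Delta> \<le> T")
      case True
      have "r i * T < r i * T0"
        using less assms(2) by simp
      moreover have "G T = G T0 - r i * (T0 - T)"
        using G[of t T] G[of t T0] True less T0 ft by (simp add: algebra_simps)
      ultimately show ?thesis
        using GT0 by (simp add: algebra_simps)
    next
      case False
      define j where "j = nat \<lfloor>T / \<Delta>\<rfloor>"
      have "real j = of_int \<lfloor>T / \<Delta>\<rfloor>"
        using that(1) assms(1) by (simp add: j_def)
      then have "real j \<le> T / \<Delta>" "T / \<Delta> \<le> real (Suc j)"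
        by linarith+
      then have j: "real j * \<Delta> \<le> T" "T \<le> real (Suc j) * \<Delta>"
        using assms(1) by (simp_all add: field_simps)
      have "real j * \<Delta> < real t * \<Delta>"
        using j(1) False by simp
      then have "Suc j \<le> t"
        using assms(1) by simp
      then have ons: "real (ons_before f (Suc j)) \<le> real (ons_before f t)"
        by (intro of_nat_mono ons_before_mono)
      have "of_bool (f j) * (T - real j * \<Delta>) \<le> of_bool (f j) * \<Delta>"
        using j(2) by (simp add: algebra_simps)
      then have "real (ons_before f j) * \<Delta> + of_bool (f j) * (T - real j * \<Delta>)
          \<le> real (ons_before f (Suc j)) * \<Delta>"
        by (simp add: algebra_simps)
      also have "\<dots> \<le> real (ons_before f t) * \<Delta>"
        using ons assms(1) by (intro mult_right_mono) auto
      also have "\<dots> < F / r i"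
        using F' n by simp
      finally show ?thesis
        using assms(2) by (simp add: G[OF j] field_simps)
    qed
    with that(2) show False by simp
  qed
  have "(LEAST T. 0 \<le> T \<and> F \<le> G T) = T0"
    by (rule Least_equality) (use GT0 T0_nonneg least in auto)
  moreover have "\<exists>T\<ge>0. F \<le> G T"
    using GT0 T0_nonneg by auto
  ultimately show ?thesis
    by (simp add: transfer_time_def G_def T0_def)
qed

lemma transfer_time_eq:
  fixes \<Delta> F :: real
  assumes "\<Delta> > 0" "r i > 0" "F > 0"
    and F: "(real n - 1) * (\<Delta> * r i) < F" "F \<le> real n * (\<Delta> * r i)"
    and "n \<le> ons_before (\<lambda>k. Y i k \<omega>) j"
  shows "transfer_time \<Delta> r Y i F \<omega>
    = ennreal (F / r i) + ennreal \<Delta> * wasted_slots n (\<lambda>k. Y i k \<omega>)"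
proof -
  have "n > 0"
    using F(2) assms(3) by (cases n) auto
  then obtain t where t: "Y i t \<omega>" "Suc (ons_before (\<lambda>k. Y i k \<omega>) t) = n"
    using nth_on_slot_exists[OF _ assms(6)] by blast
  have "n \<le> Suc t"
    using ons_before_le[of "\<lambda>k. Y i k \<omega>" t] t(2) by simp
  have "transfer_time \<Delta> r Y i F \<omega> = ennreal (F / r i + \<Delta> * real (Suc t - n))"
    using transfer_time_nth_on_slot[where r = r and i = i, OF assms(1,2) F, where Y = Y and \<omega> = \<omega> and t = t] t \<open>n \<le> Suc t\<close>
    by (simp add: of_nat_diff)
  also have "\<dots> = ennreal (F / r i) + ennreal \<Delta> * of_nat (Suc t - n)"
    using assms(1-3) by (simp add: ennreal_mult flip: ennreal_of_nat_eq_real_of_nat)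
  finally show ?thesis
    using wasted_slots_eq[of "\<lambda>k. Y i k \<omega>" t n] t by simp
qed

section \<open>Waiting for available slots of an i.i.d. channel\<close>

context prob_space
begin

context
  fixes B :: "nat \<Rightarrow> 'a \<Rightarrow> bool" and q :: real
  assumes indep: "indep_vars (\<lambda>_. count_space UNIV) B UNIV"
    and prob_on: "\<And>k. prob {\<omega> \<in> space M. B k \<omega>} = q"
    and q_pos: "q > 0"
begin

lemma measurable_B [measurable]: "B k \<in> measurable M (count_space UNIV)"
  using indep by (auto simp: indep_vars_def)

lemma measurable_ons_before [measurable]:
  "(\<lambda>\<omega>. ons_before (\<lambda>k. B k \<omega>) j) \<in> measurable M (count_space UNIV)"
  unfolding ons_before_def by measurable

lemma measurable_wasted_slots [measurable]:
  "(\<lambda>\<omega>. wasted_slots n (\<lambda>k. B k \<omega>)) \<in> borel_measurable M"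
  unfolding wasted_slots_def by measurable

lemma measurable_slots_until [measurable]:
  "(\<lambda>\<omega>. slots_until n (\<lambda>k. B k \<omega>)) \<in> borel_measurable M"
  unfolding slots_until_def by measurable

text \<open>The event that fewer than \<open>n\<close> slots before \<open>j\<close> are available is determined by slots
  before \<open>j\<close>, hence is independent of slot \<open>j\<close>.\<close>

lemma prob_used_on_slot:
  "prob {\<omega> \<in> space M. B j \<omega> \<and> ons_before (\<lambda>k. B k \<omega>) j < n}
    = q * prob {\<omega> \<in> space M. ons_before (\<lambda>k. B k \<omega>) j < n}"
proof -
  define X :: "nat \<Rightarrow> 'a \<Rightarrow> real" where "X = (\<lambda>k \<omega>. of_bool (B k \<omega>))"
  have "indep_vars (\<lambda>_. borel) X UNIV"
    unfolding X_def by (rule indep_vars_compose2[OF indep]) auto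
  then have "indep_vars (\<lambda>_. borel) X (insert j {..<j})"
    by (rule indep_vars_subset) auto
  then have "indep_var borel (X j) borel (\<lambda>\<omega>. \<Sum>l<j. X l \<omega>)"
    by (intro indep_vars_sum) auto
  then have "prob ((\<lambda>\<omega>. (X j \<omega>, \<Sum>l<j. X l \<omega>)) -` ({1} \<times> {..<real n}) \<inter> space M)
      = prob (X j -` {1} \<inter> space M) * prob ((\<lambda>\<omega>. \<Sum>l<j. X l \<omega>) -` {..<real n} \<inter> space M)"
    by (rule indep_varD) auto
  moreover have ons: "(\<Sum>l<j. X l \<omega>) = real (ons_before (\<lambda>k. B k \<omega>) j)" for \<omega>
    by (simp add: X_def ons_before_def)
  moreover have "X j -` {1} \<inter> space M = {\<omega> \<in> space M. B j \<omega>}"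
    by (auto simp: X_def)
  moreover have "(\<lambda>\<omega>. (X j \<omega>, \<Sum>l<j. X l \<omega>)) -` ({1} \<times> {..<real n}) \<inter> space M
      = {\<omega> \<in> space M. B j \<omega> \<and> ons_before (\<lambda>k. B k \<omega>) j < n}"
    unfolding ons by (auto simp: X_def)
  moreover have "(\<lambda>\<omega>. \<Sum>l<j. X l \<omega>) -` {..<real n} \<inter> space M
      = {\<omega> \<in> space M. ons_before (\<lambda>k. B k \<omega>) j < n}"
    unfolding ons by auto
  ultimately show ?thesis
    by (simp add: prob_on)
qed

lemma nn_integral_of_bool:
  assumes [measurable]: "Measurable.pred M P"
  shows "(\<integral>\<^sup>+ \<omega>. of_bool (P \<omega>) \<partial>M) = ennreal (prob {\<omega> \<in> space M. P \<omega>})"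
proof -
  have "(\<integral>\<^sup>+ \<omega>. of_bool (P \<omega>) \<partial>M) = (\<integral>\<^sup>+ \<omega>. indicator {\<omega> \<in> space M. P \<omega>} \<omega> \<partial>M)"
    by (intro nn_integral_cong) (auto simp: indicator_def)
  then show ?thesis
    by (simp add: emeasure_eq_measure)
qed

lemma wald_identity:
  "(\<integral>\<^sup>+ \<omega>. (\<Sum>j. of_bool (B j \<omega> \<and> ons_before (\<lambda>k. B k \<omega>) j < n)) \<partial>M)
    = ennreal q * (\<integral>\<^sup>+ \<omega>. slots_until n (\<lambda>k. B k \<omega>) \<partial>M)"
proof -
  have "(\<integral>\<^sup>+ \<omega>. (\<Sum>j. of_bool (B j \<omega> \<and> ons_before (\<lambda>k. B k \<omega>) j < n)) \<partial>M)
      = (\<Sum>j. ennreal q * (\<integral>\<^sup>+ \<omega>. of_bool (ons_before (\<lambda>k. B k \<omega>) j < n) \<partial>M))"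
    using q_pos by (subst nn_integral_suminf) (simp_all add: nn_integral_of_bool prob_used_on_slot ennreal_mult)
  also have "\<dots> = ennreal q * (\<integral>\<^sup>+ \<omega>. slots_until n (\<lambda>k. B k \<omega>) \<partial>M)"
    unfolding slots_until_def by (subst nn_integral_suminf) simp_all
  finally show ?thesis .
qed

text \<open>By Wald's identity and the pathwise bound on the number of used slots, the expected number of
  slots with fewer than \<open>n\<close> available predecessors is finite. So the number itself is
  almost surely finite, which means that eventually \<open>n\<close> slots have been available.\<close>

lemma AE_enough_on_slots: "AE \<omega> in M. \<exists>j. n \<le> ons_before (\<lambda>k. B k \<omega>) j"
proof -
  have "ennreal q * (\<integral>\<^sup>+ \<omega>. slots_until n (\<lambda>k. B k \<omega>) \<partial>M) \<le> (\<integral>\<^sup>+ \<omega>. of_nat n \<partial>M)"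
    unfolding wald_identity[symmetric] by (intro nn_integral_mono used_on_slots_le)
  also have "\<dots> < \<infinity>"
    by (simp add: emeasure_space_1 less_top[symmetric])
  finally have "(\<integral>\<^sup>+ \<omega>. slots_until n (\<lambda>k. B k \<omega>) \<partial>M) \<noteq> \<infinity>"
    using q_pos by (auto simp: ennreal_mult_top)
  then have "AE \<omega> in M. slots_until n (\<lambda>k. B k \<omega>) \<noteq> \<infinity>"
    by (intro nn_integral_PInf_AE) auto
  then show ?thesis
    by eventually_elim (auto intro!: slots_until_finite simp: less_top)
qed

lemma expected_used_on_slots:
  "(\<integral>\<^sup>+ \<omega>. (\<Sum>j. of_bool (B j \<omega> \<and> ons_before (\<lambda>k. B k \<omega>) j < n)) \<partial>M) = ennreal (real n)"
proof -
  have "AE \<omega> in M. (\<Sum>j. of_bool (B j \<omega> \<and> ons_before (\<lambda>k. B k \<omega>) j < n)) = (of_nat n :: ennreal)"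
    using AE_enough_on_slots[of n]
  proof eventually_elim
    case (elim \<omega>)
    then show ?case
      using used_on_slots_eq[of n "\<lambda>k. B k \<omega>"] by blast
  qed
  then have "(\<integral>\<^sup>+ \<omega>. (\<Sum>j. of_bool (B j \<omega> \<and> ons_before (\<lambda>k. B k \<omega>) j < n)) \<partial>M)
      = (\<integral>\<^sup>+ \<omega>. of_nat n \<partial>M)"
    by (rule nn_integral_cong_AE)
  then show ?thesis
    by (simp add: emeasure_space_1 ennreal_of_nat_eq_real_of_nat)
qed

lemma expected_slots_until:
  "(\<integral>\<^sup>+ \<omega>. slots_until n (\<lambda>k. B k \<omega>) \<partial>M) = ennreal (real n / q)"
proof -
  have "ennreal q * (\<integral>\<^sup>+ \<omega>. slots_until n (\<lambda>k. B k \<omega>) \<partial>M) = ennreal q * ennreal (real n / q)"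
    using wald_identity[of n] expected_used_on_slots[of n] q_pos
    by (simp flip: ennreal_mult)
  then show ?thesis
    using q_pos by (simp add: ennreal_mult_cancel_left)
qed

lemma expected_wasted_slots:
  "(\<integral>\<^sup>+ \<omega>. wasted_slots n (\<lambda>k. B k \<omega>) \<partial>M) = ennreal (real n * (1 / q - 1))"
proof -
  have "q \<le> 1"
    using prob_on[of 0] by (metis prob_le_1)
  have "(\<integral>\<^sup>+ \<omega>. slots_until n (\<lambda>k. B k \<omega>) \<partial>M)
      = (\<integral>\<^sup>+ \<omega>. wasted_slots n (\<lambda>k. B k \<omega>) \<partial>M) + ennreal (real n)"
    unfolding slots_until_split by (subst nn_integral_add) (simp_all add: expected_used_on_slots)
  moreover have "ennreal (real n / q) = ennreal (real n * (1 / q - 1)) + ennreal (real n)"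
    using q_pos \<open>q \<le> 1\<close> by (subst ennreal_plus[symmetric]) (auto simp: algebra_simps divide_simps mult_left_le_one_le)
  ultimately show ?thesis
    unfolding expected_slots_until
    by (metis add.commute ennreal_add_left_cancel ennreal_neq_top infinity_ennreal_def)
qed

end

end

section \<open>Expected transfer times and the ratio bound\<close>

context channel_model
begin

lemma expected_transfer_time_eq:
  assumes i: "i \<in> {1..N}" and "F > 0"
    and F: "(real n - 1) * (\<Delta> * r i) < F" "F \<le> real n * (\<Delta> * r i)"
  shows "expected_transfer_time M \<Delta> r Y i F = ennreal (F / r i + \<Delta> * real n * (1 / p i - 1))"
proof -
  have r: "r i > 0" and p: "0 < p i" "p i \<le> 1"
    using rate_pos[OF i] prob_range[OF i] by auto
  note iid = indep_slots[OF i] bernoulli[OF i] p(1)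
  note [measurable] = measurable_wasted_slots[OF iid]
  have "AE \<omega> in M. transfer_time \<Delta> r Y i F \<omega>
      = ennreal (F / r i) + ennreal \<Delta> * wasted_slots n (\<lambda>k. Y i k \<omega>)"
    using AE_enough_on_slots[OF iid, of n]
    by eventually_elim (auto intro: transfer_time_eq[where r = r and i = i, OF slot_pos r \<open>F > 0\<close> F])
  then have "expected_transfer_time M \<Delta> r Y i F
      = (\<integral>\<^sup>+ \<omega>. ennreal (F / r i) + ennreal \<Delta> * wasted_slots n (\<lambda>k. Y i k \<omega>) \<partial>M)"
    unfolding expected_transfer_time_def by (rule nn_integral_cong_AE)
  also have "\<dots> = ennreal (F / r i) + ennreal \<Delta> * ennreal (real n * (1 / p i - 1))"
    by (simp add: nn_integral_add nn_integral_cmult emeasure_space_1 expected_wasted_slots[OF iid])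
  also have "\<dots> = ennreal (F / r i + \<Delta> * real n * (1 / p i - 1))"
    using slot_pos r p \<open>F > 0\<close> by (simp add: mult.assoc flip: ennreal_mult ennreal_plus)
  finally show ?thesis .
qed

lemma expected_transfer_time_le:
  assumes i: "i \<in> {1..N}" and "F > 0"
  shows "expected_transfer_time M \<Delta> r Y i F
    \<le> ennreal (\<Delta> * (F / (\<Delta> * r i * p i) + (1 - p i) / p i))"
proof -
  have r: "r i > 0" and p: "0 < p i" "p i \<le> 1"
    using rate_pos[OF i] prob_range[OF i] by auto
  define n where "n = nat \<lceil>F / (\<Delta> * r i)\<rceil>"
  have "F / (\<Delta> * r i) > 0"
    using r slot_pos \<open>F > 0\<close> by simp
  then have "real n = of_int \<lceil>F / (\<Delta> * r i)\<rceil>"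
    by (simp add: n_def)
  then have n: "real n - 1 < F / (\<Delta> * r i)" "F / (\<Delta> * r i) \<le> real n"
    by linarith+
  have "expected_transfer_time M \<Delta> r Y i F = ennreal (F / r i + \<Delta> * real n * (1 / p i - 1))"
    using n r slot_pos
    by (intro expected_transfer_time_eq[OF i \<open>F > 0\<close>])
      (simp_all add: pos_less_divide_eq pos_divide_le_eq)
  also have "F / r i + \<Delta> * real n * (1 / p i - 1)
      \<le> F / r i + \<Delta> * (F / (\<Delta> * r i) + 1) * (1 / p i - 1)"
    using n(1) slot_pos p by (intro add_left_mono mult_right_mono mult_left_mono) auto
  also have "\<dots> = \<Delta> * (F / (\<Delta> * r i * p i) + (1 - p i) / p i)"
    using slot_pos r p by (simp add: field_simps)
  finally show ?thesis
    by (simp add: ennreal_leI)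
qed

lemma expected_transfer_time_ge:
  assumes i: "i \<in> {1..N}"
    and F: "real k * (\<Delta> * r i) < F" "F \<le> (real k + 1) * (\<Delta> * r i)"
  shows "ennreal (\<Delta> * ((real k + 1) * (1 / p i - 1))) \<le> expected_transfer_time M \<Delta> r Y i F"
proof -
  have r: "r i > 0"
    using rate_pos[OF i] .
  have "0 \<le> real k * (\<Delta> * r i)"
    using slot_pos r by simp
  with F have "F > 0"
    by linarith
  then have "expected_transfer_time M \<Delta> r Y i F
      = ennreal (F / r i + \<Delta> * real (Suc k) * (1 / p i - 1))"
    using F by (intro expected_transfer_time_eq[OF i]) (simp_all add: add.commute)
  also have "\<dots> \<ge> ennreal (\<Delta> * ((real k + 1) * (1 / p i - 1)))"
    using \<open>F > 0\<close> r by (intro ennreal_leI) (simp add: mult.assoc add.commute)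
  finally show ?thesis .
qed

end

lemma ennreal_inverse_antimono: "x \<le> y \<Longrightarrow> inverse y \<le> inverse x" for x y :: ennreal
  by (simp add: less_eq_ennreal.rep_eq inverse_ennreal.rep_eq ereal_inverse_antimono)

theorem corollary3p3:
  fixes M :: "'w measure" and N :: nat and \<Delta> :: real and r p m :: "nat \<Rightarrow> real"
    and Y :: "nat \<Rightarrow> nat \<Rightarrow> 'w \<Rightarrow> bool" and istar iso k :: nat and F :: real
  assumes "channel_model M N \<Delta> r p Y"
    and "unique_max_throughput N r p istar"
    and "p istar < 1"
    and "\<And>i. i \<in> {1..N} - {istar} \<Longrightarrow> m i = p i / p istar"
    and "F \<in> {real k * \<Delta> * r istar <..< (real k + 1) * \<Delta> * r istar}"
    and "static_optimal M N \<Delta> r Y F iso"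
  shows "expected_transfer_time M \<Delta> r Y iso F / expected_transfer_time M \<Delta> r Y istar F
    \<le> ennreal (Min (insert 1
        ((\<lambda>i. (F / (\<Delta> * r i * p i) + (1 - p i) / p i) / ((real k + 1) * (m i / p i - 1)))
          ` ({1..N} - {istar}))))"
proof -
  interpret channel_model M N \<Delta> r p Y by fact
  let ?E = "\<lambda>i. expected_transfer_time M \<Delta> r Y i F"
  let ?b = "\<lambda>i. (F / (\<Delta> * r i * p i) + (1 - p i) / p i) / ((real k + 1) * (m i / p i - 1))"
  have istar: "istar \<in> {1..N}"
    using assms(2) by (simp add: unique_max_throughput_def)
  have F: "real k * (\<Delta> * r istar) < F" "F < (real k + 1) * (\<Delta> * r istar)"
    using assms(5) by (simp_all add: mult.assoc)
  have "0 \<le> real k * (\<Delta> * r istar)"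
    using slot_pos rate_pos[OF istar] by simp
  with F have "F > 0"
    by linarith
  define L where "L = \<Delta> * ((real k + 1) * (1 / p istar - 1))"
  have "1 / p istar - 1 > 0"
    using prob_range[OF istar] assms(3) by simp
  then have "L > 0"
    using slot_pos by (simp add: L_def)
  have ge: "ennreal L \<le> ?E istar"
    unfolding L_def using expected_transfer_time_ge[OF istar F(1)] F(2) by simp
  have optimal: "?E iso \<le> ?E i" if "i \<in> {1..N}" for i
    using assms(6) that by (auto simp: static_optimal_def is_arg_min_linorder)
  have "?E iso / ?E istar \<le> 1"
  proof -
    have "?E iso / ?E istar \<le> ?E istar / ?E istar"
      by (intro divide_right_mono_ennreal optimal istar)
    also have "\<dots> \<le> 1"
    proof (cases "?E istar = \<top>")
      case False
      moreover have "?E istar \<noteq> 0"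
        using ge \<open>L > 0\<close> by auto
      ultimately show ?thesis
        by (simp add: ennreal_divide_self less_top)
    qed simp
    finally show ?thesis .
  qed
  moreover have "?E iso / ?E istar \<le> ennreal (?b i)" if i: "i \<in> {1..N} - {istar}" for i
  proof -
    let ?U = "\<Delta> * (F / (\<Delta> * r i * p i) + (1 - p i) / p i)"
    have pos: "r i > 0" "0 < p i" "p i \<le> 1"
      using rate_pos[of i] prob_range[of i] i by auto
    have "?E iso \<le> ennreal ?U"
      using optimal[of i] expected_transfer_time_le[of i F] \<open>F > 0\<close> i by (auto intro: order_trans)
    then have "?E iso / ?E istar \<le> ennreal ?U / ennreal L"
      using ge unfolding divide_ennreal_def by (intro mult_mono ennreal_inverse_antimono) auto
    also have "\<dots> = ennreal (?U / L)"
      using \<open>L > 0\<close> pos slot_pos \<open>F > 0\<close> by (intro divide_ennreal) auto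
    also have "?U / L = ?b i"
      using slot_pos pos assms(4)[OF i] by (simp add: L_def)
    finally show ?thesis .
  qed
  moreover have "Min (insert 1 (?b ` ({1..N} - {istar}))) \<in> insert 1 (?b ` ({1..N} - {istar}))"
    by (rule Min_in) auto
  ultimately show ?thesis
    by (metis (no_types, lifting) ennreal_1 imageE insertE)
qed

end
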